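(* Let $\tau_0 \ge 4$ (an integer) and $\psi \ge 10^5 \sqrt{\tau_0-1}\, \log^3\tau_0$ be constants. Let $G(\tau_0)$ be any graph with $\tau_0$ vertices and $\tau_0-1$ edges, and consider the preferential attachment process with initial graph $G(\tau_0)$ at time $\tau_0$. For $t\ge\tau_0$ and $\ell\ge 1$ let $D_t(\ell)$ be the number of vertices of degree exactly $\ell$ at time $t$. Then, with probability at least $1-\frac{4}{\psi}$, we have $$ \left| D_t(\ell) - \frac{4t}{\ell(\ell+1)(\ell+2)} \right| \le 120 \sqrt{\frac{t \log (\psi t)}{\ell^3}} + 301\, \psi^2 \log(\psi t) $$ for all $\ell \ge 1$ and all $t \ge \tau_0$ (simultaneously).
   Context: Preferential attachment process: start at time $\tau_0$ with a graph $G(\tau_0)$ having $\tau_0$ vertices and $\tau_0-1$ edges. At each integer time $t>\tau_0$ a new vertex is created and joined by one new edge to one existing vertex; the existing vertex $v$ is chosen with probability proportional to its degree at time $t-1$ (i.e. with probability equal to its degree at time $t-1$ divided by $2(t-2)$, the sum of all degrees at time $t-1$), the choice depending on the past only through the current graph. Thus at each time $t\ge\tau_0$ the graph has $t$ vertices and $t-1$ edges. $\log$ is the natural logarithm and $\log^3 x=(\log x)^3$. *)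

theory Defs
  imports "HOL-Probability.Probability"
begin

datatype 'v graph = Graph (verts: "'v set") (edges: "'v set set")

definition simple_graph :: "'v graph \<Rightarrow> bool" where
  "simple_graph G \<longleftrightarrow> finite (verts G) \<and> (\<forall>e\<in>edges G. e \<subseteq> verts G \<and> card e = 2)"

definition degree :: "'v graph \<Rightarrow> 'v \<Rightarrow> nat" where
  "degree G v = card {e \<in> edges G. v \<in> e}"

definition degree_count :: "'v graph \<Rightarrow> nat \<Rightarrow> nat" where
  "degree_count G l = card {v \<in> verts G. degree G v = l}"

definition attach :: "'v graph \<Rightarrow> 'v \<Rightarrow> 'v \<Rightarrow> 'v graph" where
  "attach G w v = Graph (insert w (verts G)) (insert {v, w} (edges G))"

text \<open>
  The process is any sequence of random graphs with the prescribed law. Vertices are labelled by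
  their time of arrival: the graph at time \<open>t\<close> lives on \<open>{1..t}\<close>, and the vertex created at
  time \<open>t + 1\<close> is \<open>Suc t\<close> (for this the initial graph must have vertex set \<open>{1..\<tau>\<^sub>0}\<close>). The
  transition law is conditioned on the whole history \<open>h\<close> of the process but depends only on the
  current graph \<open>h t\<close>; its denominator is the degree sum \<open>2 (t - 1)\<close> at time \<open>t\<close>. Histories of
  probability zero are excluded because \<^const>\<open>cond_prob\<close> is \<open>0\<close> for them.
\<close>

locale preferential_attachment = prob_space M for M :: "'a measure" +
  fixes \<tau>\<^sub>0 :: nat and G\<^sub>0 :: "nat graph" and G :: "nat \<Rightarrow> 'a \<Rightarrow> nat graph"
  assumes random_graph: "\<And>t. t \<ge> \<tau>\<^sub>0 \<Longrightarrow> G t \<in> M \<rightarrow>\<^sub>M count_space UNIV"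
    and initial: "AE \<omega> in M. G \<tau>\<^sub>0 \<omega> = G\<^sub>0"
    and step: "\<And>t h v. t \<ge> \<tau>\<^sub>0 \<Longrightarrow> \<P>(\<omega> in M. \<forall>s\<in>{\<tau>\<^sub>0..t}. G s \<omega> = h s) > 0 \<Longrightarrow> v \<in> verts (h t) \<Longrightarrow>
      \<P>(\<omega> in M. G (Suc t) \<omega> = attach (h t) (Suc t) v \<bar> \<forall>s\<in>{\<tau>\<^sub>0..t}. G s \<omega> = h s)
        = real (degree (h t) v) / (2 * (real t - 1))"

end

theory Submission
  imports Defs
begin

text \<open>
  Fix \<open>t\<close> and \<open>l\<close>, and let \<open>p\<^sub>s(k)\<close> be the probability that a vertex of degree \<open>k\<close> at time \<open>s\<close>
  has degree \<open>l\<close> at time \<open>t\<close>. For small \<open>\<theta>\<close> put \<open>f\<^sub>s = \<theta> p\<^sub>s + 4 \<theta>\<^sup>2 p\<^sub>s (1 - p\<^sub>s)\<close>. The drift of the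
  quadratic term dominates the second-order error of the exponential, so the exponential of
  \<open>\<Sum>\<^sub>v f\<^sub>s(deg v) + \<Sum>\<^sub>r f\<^sub>r(1)\<close>, where \<open>r\<close> ranges over the arrival times in \<open>(s, t]\<close>, is an exact
  supermartingale, with no prior control of the degree sequence. Hence
  \<open>E exp (\<theta> (D\<^sub>t(l) - m)) \<le> exp (4 \<theta>\<^sup>2 m)\<close> with \<open>m = E D\<^sub>t(l)\<close>. By duality \<open>m\<close> satisfies a forward
  recursion in \<open>t\<close> that is solved by \<open>4 (t - 1) / (l (l + 1) (l + 2))\<close> and does not increase the
  sup norm of the error, so \<open>m\<close> is within \<open>\<tau>\<^sub>0\<close> of this value. The theorem follows from a Chernoff bound
  with \<open>\<theta> = min (1/20) (sqrt (L l\<^sup>3 / t))\<close>, where \<open>L = ln (\<psi> t)\<close>, and a union bound over \<open>l < t\<close>.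
\<close>

section \<open>Exponential estimate for a single vertex\<close>

lemma exp_le_one_plus_square:
  fixes y :: real
  assumes "\<bar>y\<bar> \<le> 1"
  shows "exp y \<le> 1 + y + y\<^sup>2"
proof (cases "y \<ge> 0")
  case True
  then show ?thesis using exp_bound[of y] assms by auto
next
  case False
  have "1 - y \<le> exp (- y)" using exp_ge_add_one_self[of "- y"] by simp
  then have "exp y \<le> 1 / (1 - y)"
    using False by (simp add: exp_minus field_simps)
  also have "\<dots> \<le> 1 + y + y\<^sup>2"
  proof -
    have "(1 + y + y\<^sup>2) * (1 - y) = 1 - y * y\<^sup>2" by (simp add: algebra_simps power2_eq_square)
    moreover have "y * y\<^sup>2 \<le> 0" using False by (simp add: mult_nonpos_nonneg)
    ultimately show ?thesis using False by (simp add: pos_divide_le_eq)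
  qed
  finally show ?thesis .
qed

text \<open>The quadratic correction vanishes at \<open>a = 0\<close> and \<open>a = 1\<close>, so
  at the final time, when hit probabilities are indicators, only \<theta> times the indicator
  remains.\<close>

definition tilt :: "real \<Rightarrow> real \<Rightarrow> real" where
  "tilt \<theta> a = \<theta> * a + 4 * \<theta>\<^sup>2 * (a * (1 - a))"

text \<open>Concavity: at the average of \<open>p\<close> and \<open>q\<close> with weights
  \<open>1 - x\<close> and \<open>x\<close>, \<open>tilt\<close> exceeds the average of its values
  by exactly \<open>4 * \<theta>\<^sup>2 * x * (1 - x) * (q - p)\<^sup>2\<close>. As
  \<open>x\<close> is at most 1/2, this is at least
  \<open>2 * \<theta>\<^sup>2 * x * (q - p)\<^sup>2\<close>, which pays for the second-order error
  \<open>x * y\<^sup>2\<close> of the exponential.\<close>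

lemma tilt_step:
  assumes p: "0 \<le> p" "p \<le> 1" and q: "0 \<le> q" "q \<le> 1" and x: "0 \<le> x" "x \<le> 1 / 2"
    and \<theta>: "\<bar>\<theta>\<bar> \<le> 1 / 20"
  shows "x * (exp (tilt \<theta> q - tilt \<theta> p) - 1) \<le> tilt \<theta> ((1 - x) * p + x * q) - tilt \<theta> p"
proof -
  define y where "y = tilt \<theta> q - tilt \<theta> p"
  have y: "y = (\<theta> + 4 * \<theta>\<^sup>2 * (1 - p - q)) * (q - p)"
    unfolding y_def tilt_def by (simp add: algebra_simps)
  have "\<bar>\<theta> + 4 * \<theta>\<^sup>2 * (1 - p - q)\<bar> \<le> \<bar>\<theta>\<bar> + 4 * \<theta>\<^sup>2 * 1"
  proof (rule order_trans[OF abs_triangle_ineq], rule add_left_mono)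
    have "\<bar>1 - p - q\<bar> \<le> 1" using p q by auto
    then have "4 * \<theta>\<^sup>2 * \<bar>1 - p - q\<bar> \<le> 4 * \<theta>\<^sup>2 * 1" by (intro mult_left_mono) auto
    then show "\<bar>4 * \<theta>\<^sup>2 * (1 - p - q)\<bar> \<le> 4 * \<theta>\<^sup>2 * 1" by (simp add: abs_mult)
  qed
  \<comment> \<open>The bound 1/20 makes the quadratic term at most a fifth of the linear one. The
    slope 6/5 keeps \<open>y\<close> within [-1, 1], and its square 36/25 stays below the 2 that
    concavity provides.\<close>
  also have "\<dots> \<le> 6 / 5 * \<bar>\<theta>\<bar>"
  proof -
    have "\<bar>\<theta>\<bar> * \<bar>\<theta>\<bar> \<le> \<bar>\<theta>\<bar> * (1 / 20)" using \<theta> by (intro mult_left_mono) auto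
    then show ?thesis by (simp add: power2_eq_square)
  qed
  finally have c: "\<bar>\<theta> + 4 * \<theta>\<^sup>2 * (1 - p - q)\<bar> \<le> 6 / 5 * \<bar>\<theta>\<bar>" .
  have y_le: "\<bar>y\<bar> \<le> 6 / 5 * \<bar>\<theta>\<bar> * \<bar>q - p\<bar>"
    unfolding y abs_mult by (intro mult_right_mono c) auto
  have "6 / 5 * \<bar>\<theta>\<bar> * \<bar>q - p\<bar> \<le> 6 / 5 * (1 / 20) * 1"
    using \<theta> p q by (intro mult_mono) auto
  with y_le have "\<bar>y\<bar> \<le> 1" by linarith
  then have "exp y - 1 - y \<le> y\<^sup>2" using exp_le_one_plus_square[of y] by simp
  also have "y\<^sup>2 \<le> (6 / 5 * \<bar>\<theta>\<bar> * \<bar>q - p\<bar>)\<^sup>2"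
    using y_le by (simp add: abs_le_square_iff[symmetric] abs_mult)
  also have "\<dots> = 36 / 25 * (\<theta>\<^sup>2 * (q - p)\<^sup>2)" by (simp add: power_mult_distrib power2_eq_square)
  also have "\<dots> \<le> 2 * (\<theta>\<^sup>2 * (q - p)\<^sup>2)" by (intro mult_right_mono) auto
  also have "\<dots> = 4 * \<theta>\<^sup>2 * (1 / 2) * (q - p)\<^sup>2" by simp
  also have "\<dots> \<le> 4 * \<theta>\<^sup>2 * (1 - x) * (q - p)\<^sup>2"
    using x by (intro mult_right_mono mult_left_mono) auto
  finally have "x * (exp y - 1) \<le> x * (y + 4 * \<theta>\<^sup>2 * (1 - x) * (q - p)\<^sup>2)"
    using x by (intro mult_left_mono) auto
  also have "\<dots> = tilt \<theta> ((1 - x) * p + x * q) - tilt \<theta> p"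
    unfolding y tilt_def by (simp add: algebra_simps power2_eq_square)
  finally show ?thesis unfolding y_def .
qed

section \<open>Graphs with labelled arrivals and the effect of one attachment\<close>

text \<open>The almost sure invariant of the process. Fixing the vertex set leaves finitely many
  graphs for each \<open>t\<close>, so every expectation below is a finite sum.\<close>

definition pa_graph :: "nat \<Rightarrow> nat graph \<Rightarrow> bool" where
  "pa_graph t g \<longleftrightarrow> simple_graph g \<and> verts g = {1..t} \<and> card (edges g) = t - 1"

lemma finite_edges: "simple_graph g \<Longrightarrow> finite (edges g)"
  unfolding simple_graph_def
  by (rule finite_subset[of _ "Pow (verts g)"]) auto

lemma sum_degree:
  assumes "simple_graph g"
  shows "(\<Sum>v\<in>verts g. degree g v) = 2 * card (edges g)"
proof -
  have fin: "finite (verts g)" "finite (edges g)"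
    using assms finite_edges by (auto simp: simple_graph_def)
  have "(\<Sum>v\<in>verts g. degree g v) = (\<Sum>v\<in>verts g. \<Sum>e\<in>edges g. if v \<in> e then 1 else 0)"
    unfolding degree_def using fin by (simp add: sum.If_cases Int_def)
  also have "\<dots> = (\<Sum>e\<in>edges g. \<Sum>v\<in>verts g. if v \<in> e then 1 else 0)" by (rule sum.swap)
  also have "\<dots> = (\<Sum>e\<in>edges g. 2)"
  proof (rule sum.cong[OF refl])
    fix e assume "e \<in> edges g"
    then have "e \<subseteq> verts g" "card e = 2" using assms by (auto simp: simple_graph_def)
    moreover from this have "{v \<in> verts g. v \<in> e} = e" by auto
    ultimately show "(\<Sum>v\<in>verts g. if v \<in> e then 1 else 0) = (2 :: nat)"
      using fin by (simp add: sum.If_cases Int_def)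
  qed
  finally show ?thesis by simp
qed

lemma finite_pa_graphs: "finite {g. pa_graph t g}"
proof (rule finite_subset)
  show "{g. pa_graph t g} \<subseteq> (\<lambda>E. Graph {1..t} E) ` Pow (Pow {1..t})"
  proof
    fix g assume "g \<in> {g. pa_graph t g}"
    then have "verts g = {1..t}" "edges g \<subseteq> Pow {1..t}"
      by (auto simp: pa_graph_def simple_graph_def)
    then show "g \<in> (\<lambda>E. Graph {1..t} E) ` Pow (Pow {1..t})"
      by (intro image_eqI[of _ _ "edges g"]) (auto simp: graph.expand)
  qed
qed simp

text \<open>At most all \<open>t - 1\<close> edges meet at \<open>v\<close>. This keeps
  \<open>rate\<close> at most 1/2, as \<open>tilt_step\<close> requires.\<close>

lemma degree_less: "pa_graph t g \<Longrightarrow> t \<ge> 1 \<Longrightarrow> degree g v < t"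
  using card_mono[of "edges g" "{e \<in> edges g. v \<in> e}"] finite_edges[of g]
  by (auto simp: pa_graph_def degree_def)

context
  fixes g :: "nat graph" and t v :: nat
  assumes g: "pa_graph t g" and v: "v \<in> {1..t}"
begin

lemma new_edge: "{v, Suc t} \<notin> edges g"
  using g by (auto simp: pa_graph_def simple_graph_def)

lemma pa_graph_attach: "pa_graph (Suc t) (attach g (Suc t) v)"
proof -
  have fin: "finite (edges g)" using g finite_edges by (auto simp: pa_graph_def)
  have "e \<subseteq> {1..Suc t}" "card e = 2" if "e \<in> edges g" for e
    using g that by (fastforce simp: pa_graph_def simple_graph_def)+
  moreover have "insert (Suc t) {1..t} = {1..Suc t}" "{v, Suc t} \<subseteq> {1..Suc t}" "card {v, Suc t} = 2"
    using v by auto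
  ultimately have "simple_graph (attach g (Suc t) v)"
    using g by (simp add: pa_graph_def simple_graph_def attach_def)
  then show ?thesis
    using g v fin new_edge by (auto simp: pa_graph_def attach_def)
qed

lemma degree_attach:
  "degree (attach g (Suc t) v) u = degree g u + (if u = v \<or> u = Suc t then 1 else 0)"
proof -
  have fin: "finite (edges g)" using g finite_edges by (auto simp: pa_graph_def)
  have "{e \<in> edges (attach g (Suc t) v). u \<in> e} =
      (if u = v \<or> u = Suc t then insert {v, Suc t} {e \<in> edges g. u \<in> e} else {e \<in> edges g. u \<in> e})"
    by (auto simp: attach_def)
  then show ?thesis using new_edge fin by (simp add: degree_def)
qed

lemma degree_new_vertex: "degree g (Suc t) = 0"
proof -
  have "{e \<in> edges g. Suc t \<in> e} = {}"
    using g by (fastforce simp: pa_graph_def simple_graph_def)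
  then show ?thesis by (simp only: degree_def card.empty)
qed

lemma sum_degree_attach:
  fixes F :: "nat \<Rightarrow> real"
  shows "(\<Sum>u\<in>{1..Suc t}. F (degree (attach g (Suc t) v) u)) =
    (\<Sum>u\<in>{1..t}. F (degree g u)) + F 1 + (F (Suc (degree g v)) - F (degree g v))"
proof -
  have "(\<Sum>u\<in>{1..t}. F (degree (attach g (Suc t) v) u)) =
      (\<Sum>u\<in>{1..t}. F (degree g u) + (if u = v then F (Suc (degree g v)) - F (degree g v) else 0))"
    by (intro sum.cong) (auto simp: degree_attach)
  also have "\<dots> = (\<Sum>u\<in>{1..t}. F (degree g u)) + (F (Suc (degree g v)) - F (degree g v))"
    using v by (simp add: sum.distrib sum.delta)
  finally show ?thesis by (simp add: degree_attach degree_new_vertex)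
qed

end

text \<open>The process records graphs, not choices; injectivity recovers the chosen vertex from two
  consecutive graphs.\<close>

lemma inj_on_attach: "inj_on (attach g (Suc t)) {1..t}" if "pa_graph t g"
proof (rule inj_onI)
  fix v w assume vw: "v \<in> {1..t}" "w \<in> {1..t}" "attach g (Suc t) v = attach g (Suc t) w"
  then have "{v, Suc t} \<in> insert {w, Suc t} (edges g)" by (auto simp: attach_def)
  then have "{v, Suc t} = {w, Suc t}" using new_edge[OF that vw(1)] by auto
  then show "v = w" using vw(1,2) by (auto simp: doubleton_eq_iff)
qed

section \<open>Hit probabilities and the exponential supermartingale\<close>

definition rate :: "nat \<Rightarrow> nat \<Rightarrow> real" where
  "rate s k = real k / (2 * (real s - 1))"

lemma rate_0 [simp]: "rate s 0 = 0" by (simp add: rate_def)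

lemma rate_bounds: "k < s \<Longrightarrow> 0 \<le> rate s k \<and> rate s k \<le> 1 / 2"
  by (auto simp: rate_def divide_simps)

lemma sum_rate_degree:
  assumes "pa_graph t g" "t \<ge> 2"
  shows "(\<Sum>v\<in>{1..t}. rate t (degree g v)) = 1"
proof -
  have "(\<Sum>v\<in>{1..t}. real (degree g v)) = 2 * (real t - 1)"
    using sum_degree[of g] assms by (auto simp: pa_graph_def of_nat_diff simp flip: of_nat_sum)
  then show ?thesis using assms(2) by (simp add: rate_def flip: sum_divide_distrib)
qed

text \<open>
  \<open>hit_prob t l s k\<close> is \<open>p\<^sub>s(k)\<close>; it is a genuine probability only for \<open>k < s\<close>,
  since beyond that \<^const>\<open>rate\<close> may exceed 1; degrees at time \<open>s\<close> always lie in this range.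
\<close>

function hit_prob :: "nat \<Rightarrow> nat \<Rightarrow> nat \<Rightarrow> nat \<Rightarrow> real" where
  "hit_prob t l s k = (if s < t
     then (1 - rate s k) * hit_prob t l (Suc s) k + rate s k * hit_prob t l (Suc s) (Suc k)
     else if k = l then 1 else 0)"
  by pat_completeness auto
termination by (relation "Wellfounded.measure (\<lambda>(t, l, s, k). t - s)") auto

declare hit_prob.simps [simp del]

lemma hit_prob_end: "hit_prob t l t k = (if k = l then 1 else 0)"
  by (simp add: hit_prob.simps)

lemma hit_prob_step: "s < t \<Longrightarrow> hit_prob t l s k =
    (1 - rate s k) * hit_prob t l (Suc s) k + rate s k * hit_prob t l (Suc s) (Suc k)"
  by (simp add: hit_prob.simps[of t l s])

text \<open>The region \<open>k < s\<close> is closed under both moves of the recursion, since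
  \<open>k\<close> grows by at most one while \<open>s\<close> grows by one; inside it each step is
  a convex combination.\<close>

lemma hit_prob_bounds: "s \<le> t \<Longrightarrow> k < s \<Longrightarrow> 0 \<le> hit_prob t l s k \<and> hit_prob t l s k \<le> 1"
proof (induction s arbitrary: k rule: inc_induct)
  case base
  then show ?case by (simp add: hit_prob_end)
next
  case (step s)
  let ?p = "hit_prob t l (Suc s) k" and ?q = "hit_prob t l (Suc s) (Suc k)"
  have b: "0 \<le> ?p" "?p \<le> 1" "0 \<le> ?q" "?q \<le> 1" using step.IH[of k] step.IH[of "Suc k"] step.prems by auto
  have r: "0 \<le> rate s k" "rate s k \<le> 1 / 2" using rate_bounds[OF step.prems] by auto
  have "(1 - rate s k) * ?p + rate s k * ?q \<le> (1 - rate s k) * 1 + rate s k * 1"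
    using b r by (intro add_mono mult_left_mono) auto
  then show ?case using b r step.hyps by (simp add: hit_prob_step)
qed

text \<open>Degrees never decrease, so a vertex above \<open>l\<close> cannot return to it. This
  lets sums over degrees stop at \<open>l\<close>.\<close>

lemma hit_prob_eq_0: "s \<le> t \<Longrightarrow> l < k \<Longrightarrow> hit_prob t l s k = 0"
  by (induction s arbitrary: k rule: inc_induct) (simp_all add: hit_prob_end hit_prob_step)

definition potential :: "real \<Rightarrow> nat \<Rightarrow> nat \<Rightarrow> nat \<Rightarrow> nat graph \<Rightarrow> real" where
  "potential \<theta> t l s g = (\<Sum>v\<in>{1..s}. tilt \<theta> (hit_prob t l s (degree g v))) +
     (\<Sum>r\<in>{s<..t}. tilt \<theta> (hit_prob t l r 1))"

text \<open>
  With \<open>x\<^sub>v\<close> the summands, \<open>1 + \<Sum>\<^sub>v x\<^sub>v \<le> exp (\<Sum>\<^sub>v x\<^sub>v)\<close> decouples the vertices and leaves one instance of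
  \<open>tilt_step\<close> per vertex.
\<close>

lemma potential_step:
  assumes g: "pa_graph s g" and s: "2 \<le> s" "s < t" and \<theta>: "\<bar>\<theta>\<bar> \<le> 1 / 20"
  shows "(\<Sum>v\<in>{1..s}. rate s (degree g v) * exp (potential \<theta> t l (Suc s) (attach g (Suc s) v)))
    \<le> exp (potential \<theta> t l s g)"
proof -
  define F where "F k = tilt \<theta> (hit_prob t l (Suc s) k)" for k
  define d where "d = degree g"
  define C where "C = (\<Sum>v\<in>{1..s}. F (d v)) + (\<Sum>r\<in>{s<..t}. tilt \<theta> (hit_prob t l r 1))"
  \<comment> \<open>The vertex arriving at \<open>Suc s\<close> moves from the sum over future
    arrivals to the sum over present vertices; in both it contributes \<open>F 1\<close>.\<close>
  have "{s<..t} = insert (Suc s) {Suc s<..t}" using s by auto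
  then have C: "C = (\<Sum>v\<in>{1..s}. F (d v)) + F 1 + (\<Sum>r\<in>{Suc s<..t}. tilt \<theta> (hit_prob t l r 1))"
    by (simp add: C_def F_def)
  have pot: "potential \<theta> t l (Suc s) (attach g (Suc s) v) = C + (F (Suc (d v)) - F (d v))"
    if "v \<in> {1..s}" for v
    using sum_degree_attach[OF g that, of F] unfolding potential_def C d_def by (simp add: F_def)
  have "(\<Sum>v\<in>{1..s}. rate s (d v) * exp (F (Suc (d v)) - F (d v))) =
      1 + (\<Sum>v\<in>{1..s}. rate s (d v) * (exp (F (Suc (d v)) - F (d v)) - 1))"
    using sum_rate_degree[OF g s(1)] by (simp add: right_diff_distrib sum_subtractf d_def)
  also have "\<dots> \<le> exp (\<Sum>v\<in>{1..s}. rate s (d v) * (exp (F (Suc (d v)) - F (d v)) - 1))"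
    by (rule exp_ge_add_one_self)
  also have "\<dots> \<le> exp (\<Sum>v\<in>{1..s}. tilt \<theta> (hit_prob t l s (d v)) - F (d v))"
  proof (subst exp_le_cancel_iff, rule sum_mono)
    fix v assume "v \<in> {1..s}"
    have d: "d v < s" using degree_less[OF g] s by (simp add: d_def)
    show "rate s (d v) * (exp (F (Suc (d v)) - F (d v)) - 1) \<le> tilt \<theta> (hit_prob t l s (d v)) - F (d v)"
      unfolding F_def hit_prob_step[OF s(2)]
      using hit_prob_bounds[of "Suc s" t "d v" l] hit_prob_bounds[of "Suc s" t "Suc (d v)" l]
        rate_bounds[OF d] \<theta> s d by (intro tilt_step) auto
  qed
  finally have *: "(\<Sum>v\<in>{1..s}. rate s (d v) * exp (F (Suc (d v)) - F (d v)))
    \<le> exp (\<Sum>v\<in>{1..s}. tilt \<theta> (hit_prob t l s (d v)) - F (d v))" .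
  have "(\<Sum>v\<in>{1..s}. rate s (d v) * exp (potential \<theta> t l (Suc s) (attach g (Suc s) v))) =
      exp C * (\<Sum>v\<in>{1..s}. rate s (d v) * exp (F (Suc (d v)) - F (d v)))"
    by (simp add: pot exp_add sum_distrib_left mult_ac)
  also have "\<dots> \<le> exp C * exp (\<Sum>v\<in>{1..s}. tilt \<theta> (hit_prob t l s (d v)) - F (d v))"
    by (intro mult_left_mono *) simp
  also have "exp C * exp (\<Sum>v\<in>{1..s}. tilt \<theta> (hit_prob t l s (d v)) - F (d v)) =
      exp (potential \<theta> t l s g)"
    by (simp add: C_def potential_def d_def sum_subtractf mult_exp_exp)
  finally show ?thesis by (simp add: d_def)
qed

section \<open>Mean degree counts: closed form and duality\<close>

context
  fixes \<tau>\<^sub>0 :: nat and D\<^sub>0 :: "nat \<Rightarrow> real"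
begin

text \<open>
  \<open>mean_count n k\<close> is \<open>E D\<^sub>t(k)\<close> for \<open>t = \<tau>\<^sub>0 + n\<close>, given the initial degree counts \<open>D\<^sub>0\<close>.
\<close>

primrec mean_count :: "nat \<Rightarrow> nat \<Rightarrow> real" where
  "mean_count 0 k = D\<^sub>0 k"
| "mean_count (Suc n) k = (1 - rate (\<tau>\<^sub>0 + n) k) * mean_count n k
     + rate (\<tau>\<^sub>0 + n) (k - 1) * mean_count n (k - 1) + (if k = 1 then 1 else 0)"

lemma mean_count_eq_0:
  assumes "\<And>k. k \<ge> \<tau>\<^sub>0 \<Longrightarrow> D\<^sub>0 k = 0" "\<tau>\<^sub>0 \<ge> 1" "k \<ge> \<tau>\<^sub>0 + n"
  shows "mean_count n k = 0"
  using assms(3)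
proof (induction n arbitrary: k)
  case (Suc n)
  then have "mean_count n k = 0" "mean_count n (k - 1) = 0" "k \<noteq> 1"
    using \<open>\<tau>\<^sub>0 \<ge> 1\<close> by auto
  then show ?case by simp
qed (use assms in auto)

text \<open>The closed form solves the recursion exactly, so the error obeys the homogeneous
  recursion. For \<open>k \<le> s\<close> its coefficients \<open>1 - rate s k\<close> and
  \<open>rate s (k - 1)\<close> are nonnegative with sum at most 1, hence the initial bound on the
  error persists.\<close>

lemma mean_count_bound:
  assumes D0: "\<And>k. k \<ge> \<tau>\<^sub>0 \<Longrightarrow> D\<^sub>0 k = 0" "\<And>k. 0 \<le> D\<^sub>0 k" "\<And>k. D\<^sub>0 k \<le> real \<tau>\<^sub>0"
    and \<tau>: "\<tau>\<^sub>0 \<ge> 4" and "k \<ge> 1"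
  shows "\<bar>mean_count n k - (real (\<tau>\<^sub>0 + n) - 1) * (4 / (real k * (real k + 1) * (real k + 2)))\<bar> \<le> real \<tau>\<^sub>0"
  using \<open>k \<ge> 1\<close>
proof (induction n arbitrary: k)
  case 0
  have "1 * 2 * 3 \<le> real k * (real k + 1) * (real k + 2)"
    using 0 by (intro mult_mono) auto
  then have "4 / (real k * (real k + 1) * (real k + 2)) \<le> 1"
    using 0 by (simp add: divide_le_eq)
  then have "(real \<tau>\<^sub>0 - 1) * (4 / (real k * (real k + 1) * (real k + 2))) \<le> (real \<tau>\<^sub>0 - 1) * 1"
    using \<tau> by (intro mult_left_mono) auto
  moreover have "0 \<le> (real \<tau>\<^sub>0 - 1) * (4 / (real k * (real k + 1) * (real k + 2)))"
    using \<tau> by auto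
  ultimately show ?case using D0(2,3)[of k] by simp
next
  case (Suc n)
  define s where "s = \<tau>\<^sub>0 + n"
  define c where "c j = 4 / (real j * (real j + 1) * (real j + 2))" for j :: nat
  have s: "s \<ge> 4" using \<tau> by (simp add: s_def)
  show ?case
  proof (cases "k \<le> s")
    case True
    have r: "rate s k \<le> 1" using True s Suc.prems by (simp add: rate_def divide_simps)
    have r': "0 \<le> rate s (k - 1)" "rate s (k - 1) \<le> rate s k"
      using s Suc.prems by (auto simp: rate_def of_nat_diff divide_simps)
    have IH: "\<bar>mean_count n k - (real s - 1) * c k\<bar> \<le> real \<tau>\<^sub>0"
      using Suc unfolding s_def c_def by blast
    have IH': "\<bar>mean_count n (k - 1) - (real s - 1) * c (k - 1)\<bar> \<le> real \<tau>\<^sub>0" if "k \<noteq> 1"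
      using Suc.IH[of "k - 1"] Suc.prems that unfolding s_def c_def by auto
    \<comment> \<open>The factor \<open>real s - 1\<close> cancels the denominator of
      \<open>rate\<close>, which is why the exact solution carries \<open>t - 1\<close> and not
      \<open>t\<close>. What remains is \<open>(k + 2) * c k = (k - 1) * c (k - 1)\<close> for
      \<open>k > 1\<close>, and the source term at \<open>k = 1\<close>.\<close>
    have bal: "real s * c k = (1 - rate s k) * ((real s - 1) * c k)
        + rate s (k - 1) * ((real s - 1) * c (k - 1)) + (if k = 1 then 1 else 0)"
    proof (cases "k = 1")
      case True
      then show ?thesis using s by (simp add: c_def rate_def divide_simps algebra_simps)
    next
      case False
      then have "k = Suc (Suc (k - 2))" using Suc.prems by simp
      then obtain j where j: "k = Suc (Suc j)" by blast
      have cancel: "a / (2 * r) * (r * x) = a * x / 2" if "r \<noteq> 0" for a r x :: real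
        using that by simp
      have "rate s i * ((real s - 1) * x) = real i * x / 2" for i x
        unfolding rate_def by (rule cancel) (use s in simp)
      note bal_terms = this[of k "c k"] this[of "k - 1" "c (k - 1)"]
      have "c k + real k * c k / 2 = real (k - 1) * c (k - 1) / 2"
        by (simp add: c_def j divide_simps) (simp add: algebra_simps)
      with bal_terms show ?thesis using False by (simp add: algebra_simps)
    qed
    have "mean_count (Suc n) k - real s * c k = (1 - rate s k) * (mean_count n k - (real s - 1) * c k)
        + rate s (k - 1) * (mean_count n (k - 1) - (real s - 1) * c (k - 1))"
      unfolding bal by (simp add: s_def algebra_simps)
    also have "\<bar>\<dots>\<bar> \<le> (1 - rate s k) * \<bar>mean_count n k - (real s - 1) * c k\<bar>
        + rate s (k - 1) * \<bar>mean_count n (k - 1) - (real s - 1) * c (k - 1)\<bar>"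
      using r r' by (intro order_trans[OF abs_triangle_ineq]) (simp add: abs_mult)
    \<comment> \<open>At \<open>k = 1\<close> there is no induction hypothesis for
      \<open>k - 1\<close>, but \<open>rate s 0 = 0\<close> removes that term.\<close>
    also have "\<dots> \<le> (1 - rate s k) * real \<tau>\<^sub>0 + rate s (k - 1) * real \<tau>\<^sub>0"
      using IH IH' r r' by (cases "k = 1") (auto intro!: add_mono mult_left_mono)
    also have "\<dots> \<le> real \<tau>\<^sub>0"
      using mult_right_mono[OF r'(2), of "real \<tau>\<^sub>0"] by (simp add: algebra_simps)
    finally show ?thesis by (simp add: s_def c_def)
  next
    case False
    \<comment> \<open>Beyond the support of the counts the error is the closed form alone, which is
      at most 4 and hence at most \<open>\<tau>\<^sub>0\<close>.\<close>
    then have "mean_count (Suc n) k = 0"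
      using D0(1) \<tau> by (intro mean_count_eq_0) (auto simp: s_def)
    moreover have "\<bar>real s * c k\<bar> \<le> 4"
    proof -
      have "real s * 1 * 1 \<le> real k * (real k + 1) * (real k + 2)"
        using False by (intro mult_mono) auto
      then show ?thesis using Suc.prems by (simp add: c_def divide_le_eq abs_mult)
    qed
    ultimately show ?thesis using \<tau> by (simp add: s_def c_def)
  qed
qed

text \<open>The forward recursion of \<open>mean_count\<close> is adjoint to the backward recursion
  of \<open>hit_prob\<close>, so their pairing changes in a step only by the newcomer's term
  \<open>hit_prob t l (Suc s) 1\<close>. At time \<open>t\<close> the pairing reduces to the single
  count at \<open>l\<close>.\<close>

lemma mean_count_duality:
  assumes "l \<ge> 1" "\<tau>\<^sub>0 + n \<le> t"
  shows "(\<Sum>k\<le>l. mean_count n k * hit_prob t l (\<tau>\<^sub>0 + n) k) =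
    (\<Sum>k\<le>l. D\<^sub>0 k * hit_prob t l \<tau>\<^sub>0 k) + (\<Sum>r\<in>{\<tau>\<^sub>0<..\<tau>\<^sub>0 + n}. hit_prob t l r 1)"
  using assms(2)
proof (induction n)
  case (Suc n)
  define s where "s = \<tau>\<^sub>0 + n"
  define p where "p = hit_prob t l (Suc s)"
  have st: "s < t" "s \<le> t" using Suc.prems by (auto simp: s_def)
  \<comment> \<open>The index shift has no boundary terms: \<open>rate s 0 = 0\<close> at the
    bottom, where \<open>0 - 1 = 0\<close>, and \<open>p (Suc l) = 0\<close> at the top.\<close>
  have shift: "(\<Sum>k\<le>l. rate s (k - 1) * mean_count n (k - 1) * p k) =
      (\<Sum>k\<le>l. rate s k * mean_count n k * p (Suc k))"
  proof -
    obtain l' where l': "l = Suc l'" using assms(1) by (cases l) auto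
    have "p (Suc l) = 0" unfolding p_def using st by (intro hit_prob_eq_0) auto
    then have "(\<Sum>k\<le>l. rate s k * mean_count n k * p (Suc k)) =
        (\<Sum>k\<le>l'. rate s k * mean_count n k * p (Suc k))" by (simp add: l')
    then show ?thesis unfolding l' sum.atMost_Suc_shift[of _ l'] by simp
  qed
  have "(\<Sum>k\<le>l. mean_count (Suc n) k * p k) =
      (\<Sum>k\<le>l. (1 - rate s k) * mean_count n k * p k)
      + (\<Sum>k\<le>l. rate s (k - 1) * mean_count n (k - 1) * p k) + (\<Sum>k\<le>l. if k = 1 then p k else 0)"
    unfolding mean_count.simps s_def[symmetric] sum.distrib[symmetric]
    by (intro sum.cong refl) (simp add: algebra_simps)
  also have "\<dots> = (\<Sum>k\<le>l. mean_count n k * hit_prob t l s k) + p 1"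
    unfolding shift using assms(1)
    by (simp add: hit_prob_step[OF st(1)] sum.delta' p_def sum.distrib[symmetric] algebra_simps)
  also have "\<dots> = (\<Sum>k\<le>l. D\<^sub>0 k * hit_prob t l \<tau>\<^sub>0 k) + (\<Sum>r\<in>{\<tau>\<^sub>0<..s}. hit_prob t l r 1) + p 1"
    using Suc by (simp add: s_def)
  also have "\<dots> = (\<Sum>k\<le>l. D\<^sub>0 k * hit_prob t l \<tau>\<^sub>0 k) + (\<Sum>r\<in>{\<tau>\<^sub>0<..Suc s}. hit_prob t l r 1)"
  proof -
    have "{\<tau>\<^sub>0<..Suc s} = insert (Suc s) {\<tau>\<^sub>0<..s}" by (auto simp: s_def)
    then show ?thesis by (simp add: p_def)
  qed
  finally show ?case by (simp add: s_def p_def)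
qed simp

end

section \<open>The one-step law of the process\<close>

text \<open>Applied twice: to the partition by the current graph, and to the finer one by graph and
  chosen vertex.\<close>

lemma (in prob_space) finite_partition_expectation:
  fixes X :: "'a \<Rightarrow> real"
  assumes "finite I" and P: "\<And>i. i \<in> I \<Longrightarrow> {\<omega> \<in> space M. P i \<omega>} \<in> events"
    and X: "X \<in> borel_measurable M"
    and ae: "AE \<omega> in M. \<exists>!i. i \<in> I \<and> P i \<omega>"
    and val: "\<And>i \<omega>. i \<in> I \<Longrightarrow> P i \<omega> \<Longrightarrow> X \<omega> = x i"
  shows "has_bochner_integral M X (\<Sum>i\<in>I. x i * \<P>(\<omega> in M. P i \<omega>))"
proof (rule has_bochner_integralI_AE[OF _ X])
  show "has_bochner_integral M (\<lambda>\<omega>. \<Sum>i\<in>I. x i * indicator {\<omega> \<in> space M. P i \<omega>} \<omega>)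
      (\<Sum>i\<in>I. x i * \<P>(\<omega> in M. P i \<omega>))"
    using P by (intro has_bochner_integral_sum has_bochner_integral_mult_right
        has_bochner_integral_real_indicator) (auto simp: emeasure_eq_measure)
  show "AE \<omega> in M. (\<Sum>i\<in>I. x i * indicator {\<omega> \<in> space M. P i \<omega>} \<omega>) = X \<omega>"
    using ae AE_space
  proof eventually_elim
    case (elim \<omega>)
    then obtain i where i: "i \<in> I" "P i \<omega>" "\<And>j. j \<in> I \<Longrightarrow> P j \<omega> \<Longrightarrow> j = i" by blast
    have "(\<Sum>j\<in>I. x j * indicator {\<omega> \<in> space M. P j \<omega>} \<omega>) = (\<Sum>j\<in>I. if j = i then x i else 0)"
    proof (rule sum.cong[OF refl])
      fix j assume "j \<in> I"
      then have "\<omega> \<in> {\<omega> \<in> space M. P j \<omega>} \<longleftrightarrow> j = i"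
        using i(1,2) i(3)[of j] elim(2) by blast
      then show "x j * indicator {\<omega> \<in> space M. P j \<omega>} \<omega> = (if j = i then x i else 0)"
        by (simp add: indicator_def)
    qed
    then show ?case using i(1) val[OF i(1,2)] \<open>finite I\<close> by (simp add: sum.delta)
  qed
qed

locale attachment_tree = preferential_attachment M \<tau>\<^sub>0 G\<^sub>0 G
  for M :: "'a measure" and \<tau>\<^sub>0 G\<^sub>0 G +
  assumes start: "\<tau>\<^sub>0 \<ge> 4" and pa_graph_start: "pa_graph \<tau>\<^sub>0 G\<^sub>0"
begin

lemma events_G: "t \<ge> \<tau>\<^sub>0 \<Longrightarrow> {\<omega> \<in> space M. P (G t \<omega>)} \<in> events"
  using measurable_sets[OF random_graph[of t], of "{g. P g}"] by (simp add: vimage_def Int_def conj_commute)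

lemma borel_G: "t \<ge> \<tau>\<^sub>0 \<Longrightarrow> (\<lambda>\<omega>. f (G t \<omega>) :: real) \<in> borel_measurable M"
  by (rule measurable_compose[OF random_graph]) auto

lemma events_history: "{\<omega> \<in> space M. \<forall>s\<in>{\<tau>\<^sub>0..t}. G s \<omega> = h s} \<in> events"
  by (intro sets.sets_Collect_finite_All events_G) auto

definition attachments :: "nat \<Rightarrow> (nat graph \<times> nat) set" where
  "attachments t = {g. pa_graph t g} \<times> {1..t}"

definition joins :: "nat \<Rightarrow> nat graph \<times> nat \<Rightarrow> 'a \<Rightarrow> bool" where
  "joins t gv \<omega> \<longleftrightarrow> G t \<omega> = fst gv \<and> G (Suc t) \<omega> = attach (fst gv) (Suc t) (snd gv)"

lemma finite_attachments: "finite (attachments t)"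
  unfolding attachments_def using finite_pa_graphs by auto

lemma events_joins: "t \<ge> \<tau>\<^sub>0 \<Longrightarrow> {\<omega> \<in> space M. joins t gv \<omega>} \<in> events"
  unfolding joins_def by (intro sets.sets_Collect_conj events_G) auto

lemma joins_unique:
  assumes "gv \<in> attachments t" "gw \<in> attachments t" "joins t gv \<omega>" "joins t gw \<omega>"
  shows "gv = gw"
proof -
  have "fst gv = fst gw" using assms by (simp add: joins_def)
  moreover have "snd gv = snd gw"
    using assms inj_onD[OF inj_on_attach, of t "fst gv" "snd gv" "snd gw"]
    by (auto simp: joins_def attachments_def)
  ultimately show ?thesis by (rule prod_eqI)
qed

text \<open>The transition law conditions on whole histories; summing over the finitely many
  histories that end in \<open>g\<close> removes them, because the rate depends on \<open>g\<close>
  alone. Null histories contribute 0 to both sides.\<close>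

lemma prob_joins:
  assumes t: "t \<ge> \<tau>\<^sub>0" and ae: "AE \<omega> in M. \<forall>s\<in>{\<tau>\<^sub>0..t}. pa_graph s (G s \<omega>)"
    and g: "pa_graph t g" and v: "v \<in> {1..t}"
  shows "\<P>(\<omega> in M. joins t (g, v) \<omega>) = \<P>(\<omega> in M. G t \<omega> = g) * rate t (degree g v)"
proof -
  define H where "H = {h \<in> PiE {\<tau>\<^sub>0..t} (\<lambda>s. {g. pa_graph s g}). h t = g}"
  define hist where "hist h \<omega> \<longleftrightarrow> (\<forall>s\<in>{\<tau>\<^sub>0..t}. G s \<omega> = h s)" for h \<omega>
  have "finite H" unfolding H_def
    by (rule finite_subset[OF _ finite_PiE[of "{\<tau>\<^sub>0..t}" "\<lambda>s. {g. pa_graph s g}"]])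
      (auto intro: finite_pa_graphs)
  have ev: "{\<omega> \<in> space M. hist h \<omega>} \<in> events" for h
    unfolding hist_def by (rule events_history)
  have split: "\<P>(\<omega> in M. G t \<omega> = g \<and> Q \<omega>) = (\<Sum>h\<in>H. \<P>(\<omega> in M. hist h \<omega> \<and> Q \<omega>))"
    if Q: "{\<omega> \<in> space M. Q \<omega>} \<in> events" for Q
  proof (rule prob_sum[OF \<open>finite H\<close>])
    show "AE \<omega> in M. (\<forall>h\<in>H. hist h \<omega> \<and> Q \<omega> \<longrightarrow> G t \<omega> = g \<and> Q \<omega>) \<and>
        (G t \<omega> = g \<and> Q \<omega> \<longrightarrow> (\<exists>!h. h \<in> H \<and> hist h \<omega> \<and> Q \<omega>))"
      using ae
    proof eventually_elim
      case (elim \<omega>)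
      have "\<exists>!h. h \<in> H \<and> hist h \<omega> \<and> Q \<omega>" if "G t \<omega> = g" "Q \<omega>"
      proof (rule ex1I)
        show "restrict (\<lambda>s. G s \<omega>) {\<tau>\<^sub>0..t} \<in> H \<and> hist (restrict (\<lambda>s. G s \<omega>) {\<tau>\<^sub>0..t}) \<omega> \<and> Q \<omega>"
          using elim that t by (auto simp: H_def hist_def)
        show "h = restrict (\<lambda>s. G s \<omega>) {\<tau>\<^sub>0..t}" if "h \<in> H \<and> hist h \<omega> \<and> Q \<omega>" for h
          using that by (auto simp: H_def hist_def PiE_def extensional_def restrict_def)
      qed
      moreover have "G t \<omega> = g" if "h \<in> H" "hist h \<omega>" for h
        using that t by (auto simp: H_def hist_def)
      ultimately show ?case by blast
    qed
  qed (use ev Q t in \<open>auto intro!: sets.sets_Collect_conj events_G\<close>)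
  have hist: "\<P>(\<omega> in M. hist h \<omega> \<and> G (Suc t) \<omega> = attach g (Suc t) v) =
      \<P>(\<omega> in M. hist h \<omega>) * rate t (degree g v)" if h: "h \<in> H" for h
  proof (cases "\<P>(\<omega> in M. hist h \<omega>) > 0")
    case True
    have ht: "h t = g" "v \<in> verts g" using h v g by (auto simp: H_def pa_graph_def)
    have "\<P>(\<omega> in M. G (Suc t) \<omega> = attach g (Suc t) v \<bar> hist h \<omega>) = rate t (degree g v)"
      using step[OF t, of h v] True ht unfolding hist_def rate_def by simp
    then show ?thesis using True by (simp add: cond_prob_def field_simps conj_commute)
  next
    case False
    then have "\<P>(\<omega> in M. hist h \<omega>) = 0" by (simp add: zero_less_measure_iff)
    moreover have "\<P>(\<omega> in M. hist h \<omega> \<and> G (Suc t) \<omega> = attach g (Suc t) v) \<le> \<P>(\<omega> in M. hist h \<omega>)"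
      by (rule finite_measure_mono) (use ev in auto)
    ultimately show ?thesis by (simp add: measure_le_0_iff)
  qed
  have "\<P>(\<omega> in M. joins t (g, v) \<omega>) =
      (\<Sum>h\<in>H. \<P>(\<omega> in M. hist h \<omega> \<and> G (Suc t) \<omega> = attach g (Suc t) v))"
    unfolding joins_def fst_conv snd_conv by (rule split) (use t in \<open>auto intro: events_G\<close>)
  also have "\<dots> = (\<Sum>h\<in>H. \<P>(\<omega> in M. hist h \<omega>)) * rate t (degree g v)"
    by (simp add: hist sum_distrib_right)
  also have "(\<Sum>h\<in>H. \<P>(\<omega> in M. hist h \<omega>)) = \<P>(\<omega> in M. G t \<omega> = g)"
    using split[of "\<lambda>_. True"] by simp
  finally show ?thesis .
qed

lemma sum_attachments:
  assumes "t \<ge> 2"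
  shows "(\<Sum>gv\<in>attachments t. F (fst gv) * rate t (degree (fst gv) (snd gv))) =
    (\<Sum>g | pa_graph t g. F g :: real)"
proof -
  have "(\<Sum>gv\<in>attachments t. F (fst gv) * rate t (degree (fst gv) (snd gv))) =
      (\<Sum>g | pa_graph t g. F g * (\<Sum>v\<in>{1..t}. rate t (degree g v)))"
    unfolding attachments_def sum_distrib_left
    by (subst sum.cartesian_product) (simp add: case_prod_beta)
  also have "\<dots> = (\<Sum>g | pa_graph t g. F g)"
    using assms sum_rate_degree by (intro sum.cong) auto
  finally show ?thesis .
qed

lemma prob_pa_graph_sum:
  assumes "t \<ge> \<tau>\<^sub>0" "AE \<omega> in M. pa_graph t (G t \<omega>)"
  shows "(\<Sum>g | pa_graph t g. \<P>(\<omega> in M. G t \<omega> = g)) = 1"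
proof -
  have "\<P>(\<omega> in M. True) = (\<Sum>g | pa_graph t g. \<P>(\<omega> in M. G t \<omega> = g))"
  proof (rule prob_sum[OF finite_pa_graphs])
    show "AE \<omega> in M. (\<forall>g\<in>{g. pa_graph t g}. G t \<omega> = g \<longrightarrow> True) \<and>
        (True \<longrightarrow> (\<exists>!g. g \<in> {g. pa_graph t g} \<and> G t \<omega> = g))"
      using assms(2) by eventually_elim auto
  qed (use assms(1) in \<open>auto intro: events_G\<close>)
  then show ?thesis by (simp add: prob_space)
qed

text \<open>The transition law gives probabilities of attachments without saying that nothing else
  happens. These probabilities add up to 1, so almost surely nothing else does.\<close>

lemma AE_joins_step:
  assumes t: "t \<ge> \<tau>\<^sub>0" and ae: "AE \<omega> in M. \<forall>s\<in>{\<tau>\<^sub>0..t}. pa_graph s (G s \<omega>)"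
  shows "AE \<omega> in M. \<exists>gv\<in>attachments t. joins t gv \<omega>"
proof -
  have "\<P>(\<omega> in M. \<exists>gv\<in>attachments t. joins t gv \<omega>) = (\<Sum>gv\<in>attachments t. \<P>(\<omega> in M. joins t gv \<omega>))"
  proof (rule prob_sum[OF finite_attachments])
    show "AE \<omega> in M. (\<forall>gv\<in>attachments t. joins t gv \<omega> \<longrightarrow> (\<exists>gv\<in>attachments t. joins t gv \<omega>)) \<and>
        ((\<exists>gv\<in>attachments t. joins t gv \<omega>) \<longrightarrow> (\<exists>!gv. gv \<in> attachments t \<and> joins t gv \<omega>))"
      using joins_unique[of _ t] by (intro AE_I2) blast
  qed (use t finite_attachments in \<open>auto intro!: sets.sets_Collect_finite_Ex events_joins\<close>)
  also have "\<dots> = (\<Sum>gv\<in>attachments t. \<P>(\<omega> in M. G t \<omega> = fst gv) * rate t (degree (fst gv) (snd gv)))"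
    using prob_joins[OF t ae] by (intro sum.cong) (auto simp: attachments_def)
  also have "\<dots> = (\<Sum>g | pa_graph t g. \<P>(\<omega> in M. G t \<omega> = g))"
    using t start by (intro sum_attachments) auto
  also have "\<dots> = 1"
    using t ae by (intro prob_pa_graph_sum) auto
  finally show ?thesis
    using t finite_attachments
    by (subst (asm) prob_Collect_eq_1) (auto intro!: sets.sets_Collect_finite_Ex events_joins)
qed

lemma AE_pa_graph: "t \<ge> \<tau>\<^sub>0 \<Longrightarrow> AE \<omega> in M. \<forall>s\<in>{\<tau>\<^sub>0..t}. pa_graph s (G s \<omega>)"
proof (induction t rule: dec_induct)
  case base
  show ?case using initial by eventually_elim (auto simp: pa_graph_start)
next
  case (step t)
  from AE_joins_step[OF step.hyps(1) step.IH] step.IH show ?case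
  proof eventually_elim
    case (elim \<omega>)
    then have "pa_graph (Suc t) (G (Suc t) \<omega>)"
      using pa_graph_attach by (force simp: attachments_def joins_def)
    with elim show ?case by (auto simp: le_Suc_eq)
  qed
qed

lemma expectation_G:
  assumes t: "t \<ge> \<tau>\<^sub>0"
  shows "has_bochner_integral M (\<lambda>\<omega>. f (G t \<omega>)) (\<Sum>g | pa_graph t g. f g * \<P>(\<omega> in M. G t \<omega> = g))"
proof (rule finite_partition_expectation[OF finite_pa_graphs])
  show "AE \<omega> in M. \<exists>!g. g \<in> {g. pa_graph t g} \<and> G t \<omega> = g"
    using AE_pa_graph[OF t] by eventually_elim (use t in auto)
qed (use t in \<open>auto intro: events_G borel_G\<close>)

lemma expectation_G_Suc:
  assumes t: "t \<ge> \<tau>\<^sub>0"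
  shows "has_bochner_integral M (\<lambda>\<omega>. f (G (Suc t) \<omega>))
    (\<Sum>g | pa_graph t g. (\<Sum>v\<in>{1..t}. rate t (degree g v) * f (attach g (Suc t) v)) * \<P>(\<omega> in M. G t \<omega> = g))"
proof -
  have "has_bochner_integral M (\<lambda>\<omega>. f (G (Suc t) \<omega>))
      (\<Sum>gv\<in>attachments t. f (attach (fst gv) (Suc t) (snd gv)) * \<P>(\<omega> in M. joins t gv \<omega>))"
  proof (rule finite_partition_expectation[OF finite_attachments])
    show "AE \<omega> in M. \<exists>!gv. gv \<in> attachments t \<and> joins t gv \<omega>"
      using AE_joins_step[OF t AE_pa_graph[OF t]] by eventually_elim (use joins_unique in blast)
  qed (use t in \<open>simp_all add: events_joins borel_G\<close>, simp add: joins_def)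
  also have "(\<Sum>gv\<in>attachments t. f (attach (fst gv) (Suc t) (snd gv)) * \<P>(\<omega> in M. joins t gv \<omega>)) =
      (\<Sum>g | pa_graph t g. \<Sum>v\<in>{1..t}. f (attach g (Suc t) v) * \<P>(\<omega> in M. joins t (g, v) \<omega>))"
    unfolding attachments_def by (subst sum.cartesian_product) (simp add: case_prod_beta)
  also have "\<dots> = (\<Sum>g | pa_graph t g.
      (\<Sum>v\<in>{1..t}. rate t (degree g v) * f (attach g (Suc t) v)) * \<P>(\<omega> in M. G t \<omega> = g))"
    using prob_joins[OF t AE_pa_graph[OF t]]
    by (intro sum.cong refl) (simp add: sum_distrib_right sum_distrib_left mult_ac)
  finally show ?thesis .
qed

text \<open>Averaging \<open>potential_step\<close> over the current graph gives the supermartingale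
  inequality directly for expectations.\<close>

lemma exp_potential_antimono:
  assumes \<theta>: "\<bar>\<theta>\<bar> \<le> 1 / 20" and "\<tau>\<^sub>0 \<le> s" "s \<le> t"
  shows "expectation (\<lambda>\<omega>. exp (potential \<theta> t l s (G s \<omega>))) \<le> exp (potential \<theta> t l \<tau>\<^sub>0 G\<^sub>0)"
  using assms(2,3)
proof (induction s rule: dec_induct)
  case base
  have "expectation (\<lambda>\<omega>. exp (potential \<theta> t l \<tau>\<^sub>0 (G \<tau>\<^sub>0 \<omega>))) =
      expectation (\<lambda>\<omega>. exp (potential \<theta> t l \<tau>\<^sub>0 G\<^sub>0))"
    using initial by (intro integral_cong_AE borel_G) auto
  then show ?case by (simp add: prob_space)
next
  case (step s)
  have "expectation (\<lambda>\<omega>. exp (potential \<theta> t l (Suc s) (G (Suc s) \<omega>))) =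
      (\<Sum>g | pa_graph s g. (\<Sum>v\<in>{1..s}. rate s (degree g v) *
        exp (potential \<theta> t l (Suc s) (attach g (Suc s) v))) * \<P>(\<omega> in M. G s \<omega> = g))"
    using expectation_G_Suc[OF step.hyps(1)] by (rule has_bochner_integral_integral_eq)
  also have "\<dots> \<le> (\<Sum>g | pa_graph s g. exp (potential \<theta> t l s g) * \<P>(\<omega> in M. G s \<omega> = g))"
    using step.hyps step.prems start \<theta>
    by (intro sum_mono mult_right_mono potential_step) auto
  also have "\<dots> = expectation (\<lambda>\<omega>. exp (potential \<theta> t l s (G s \<omega>)))"
    using expectation_G[OF step.hyps(1)] by (rule has_bochner_integral_integral_eq[symmetric])
  also have "\<dots> \<le> exp (potential \<theta> t l \<tau>\<^sub>0 G\<^sub>0)"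
    using step by auto
  finally show ?case .
qed

end

section \<open>Exponential moments and tail bounds for degree counts\<close>

lemma sum_degree_count:
  fixes F :: "nat \<Rightarrow> real"
  assumes "finite (verts g)" and F: "\<And>k. k > l \<Longrightarrow> F k = 0"
  shows "(\<Sum>v\<in>verts g. F (degree g v)) = (\<Sum>k\<le>l. real (degree_count g k) * F k)"
proof -
  have "(\<Sum>k\<le>l. real (degree_count g k) * F k) =
      (\<Sum>k\<le>l. \<Sum>v\<in>verts g. if degree g v = k then F k else 0)"
    unfolding degree_count_def using assms(1) by (simp add: sum.If_cases Int_def)
  also have "\<dots> = (\<Sum>v\<in>verts g. \<Sum>k\<le>l. if degree g v = k then F k else 0)" by (rule sum.swap)
  also have "\<dots> = (\<Sum>v\<in>verts g. F (degree g v))"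
    using F by (intro sum.cong refl) (simp add: sum.delta')
  finally show ?thesis by simp
qed

lemma degree_count_eq_0: "pa_graph t g \<Longrightarrow> 1 \<le> t \<Longrightarrow> t \<le> k \<Longrightarrow> degree_count g k = 0"
  by (auto simp: degree_count_def card_eq_0_iff dest: degree_less leD)

lemma degree_count_le: "pa_graph t g \<Longrightarrow> degree_count g k \<le> t"
proof -
  assume "pa_graph t g"
  then have "degree_count g k = card {v \<in> {1..t}. degree g v = k}"
    by (simp add: pa_graph_def degree_count_def)
  also have "\<dots> \<le> card {1..t}" by (rule card_mono) auto
  finally show ?thesis by simp
qed

text \<open>Dropping the negative square makes the initial potential linear in the hit
  probabilities, so that duality can evaluate it.\<close>

lemma tilt_le: "tilt \<theta> a \<le> (\<theta> + 4 * \<theta>\<^sup>2) * a"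
proof -
  have "tilt \<theta> a = (\<theta> + 4 * \<theta>\<^sup>2) * a - (2 * \<theta> * a)\<^sup>2"
    by (simp add: tilt_def algebra_simps power2_eq_square)
  then show ?thesis by simp
qed

lemma potential_end:
  assumes "pa_graph t g"
  shows "potential \<theta> t l t g = \<theta> * real (degree_count g l)"
proof -
  have "potential \<theta> t l t g = (\<Sum>v\<in>{1..t}. if degree g v = l then \<theta> else 0)"
    by (simp add: potential_def hit_prob_end tilt_def if_distrib cong: if_cong)
  also have "\<dots> = \<theta> * real (degree_count g l)"
    using assms by (simp add: sum.If_cases degree_count_def pa_graph_def Int_def)
  finally show ?thesis .
qed

text \<open>For \<open>a \<ge> 400 * L\<close> take \<open>sqrt (L / a)\<close>, at most 1/20
  because 400 is the square of 20: the square-root part of \<open>u\<close> yields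
  \<open>120 * L\<close> against \<open>16 * L\<close> from \<open>4 * a\<close>, and the part with
  \<open>P\<close> absorbs \<open>s\<close>. Otherwise 1/20 works, as \<open>u / 20\<close> is at
  least \<open>15 * P * L\<close> while \<open>m / 100\<close> is at most
  \<open>16 * L + P / 100\<close>.\<close>

lemma tilt_choice:
  fixes a L P s m u :: real
  assumes "a \<ge> 0" "L \<ge> 1" "P \<ge> 10" "s \<le> P" "m \<le> 4 * a + s"
    and u: "u \<ge> 120 * sqrt (a * L) + 300 * P * L"
  obtains \<theta> where "0 < \<theta>" "\<theta> \<le> 1 / 20" "- \<theta> * u + 4 * \<theta>\<^sup>2 * m \<le> - 4 * L"
proof (cases "a \<ge> 400 * L")
  case True
  define \<theta> where "\<theta> = sqrt (L / a)"
  have a: "a > 0" using True assms(2) by linarith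
  have \<theta>: "0 < \<theta>" using a assms(2) by (simp add: \<theta>_def)
  have "L / a \<le> (1 / 20)\<^sup>2" using True a by (simp add: divide_le_eq power2_eq_square)
  then have \<theta>_le: "\<theta> \<le> 1 / 20" unfolding \<theta>_def by (rule real_le_lsqrt[rotated]) simp
  have \<theta>2: "\<theta>\<^sup>2 * a = L" using a assms(2) by (simp add: \<theta>_def)
  have "\<theta> * sqrt (a * L) = sqrt (L\<^sup>2)"
    unfolding \<theta>_def using a by (simp add: power2_eq_square flip: real_sqrt_mult)
  then have "\<theta> * sqrt (a * L) = L" using assms(2) by simp
  then have "\<theta> * (120 * sqrt (a * L) + 300 * P * L) = 120 * L + 300 * (\<theta> * (P * L))"
    by (simp add: algebra_simps)
  then have 1: "\<theta> * u \<ge> 120 * L + 300 * (\<theta> * (P * L))"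
    using mult_left_mono[OF u, of \<theta>] \<theta> by simp
  have "\<theta>\<^sup>2 * m \<le> \<theta>\<^sup>2 * (4 * a + P)" using assms by (intro mult_left_mono) auto
  then have 2: "\<theta>\<^sup>2 * m \<le> 4 * L + \<theta>\<^sup>2 * P" using \<theta>2 by (simp add: algebra_simps)
  have "\<theta> * \<theta> * P \<le> \<theta> * 1 * (P * L)"
    using \<theta> \<theta>_le assms by (intro mult_mono) auto
  then have 3: "\<theta>\<^sup>2 * P \<le> \<theta> * (P * L)" by (simp add: power2_eq_square)
  have "0 \<le> \<theta> * (P * L)" using \<theta> assms by simp
  with 1 2 3 assms(2) have "- \<theta> * u + 4 * \<theta>\<^sup>2 * m \<le> - 4 * L" by simp
  with \<theta> \<theta>_le show ?thesis by (rule that)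
next
  case False
  have "P * 1 \<le> P * L" "10 * L \<le> P * L" using assms by (auto intro: mult_left_mono mult_right_mono)
  moreover have "300 * (P * L) \<le> u"
  proof -
    have "0 \<le> sqrt (a * L)" using assms by simp
    with u show ?thesis by linarith
  qed
  ultimately have "m / 100 - u / 20 \<le> - 4 * L"
    using False assms(2-5) by linarith
  then show ?thesis using that[of "1 / 20"] by (simp add: power2_eq_square)
qed

context attachment_tree
begin

text \<open>Given by the forward recursion rather than as an integral, so that
  \<open>mean_count_bound\<close> and \<open>mean_count_duality\<close> apply to it.\<close>

definition mean :: "nat \<Rightarrow> nat \<Rightarrow> real" where
  "mean t l = mean_count \<tau>\<^sub>0 (\<lambda>k. real (degree_count G\<^sub>0 k)) (t - \<tau>\<^sub>0) l"

lemma potential_start: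
  assumes "\<tau>\<^sub>0 \<le> t" "1 \<le> l"
  shows "potential \<theta> t l \<tau>\<^sub>0 G\<^sub>0 \<le> (\<theta> + 4 * \<theta>\<^sup>2) * mean t l"
proof -
  have V: "verts G\<^sub>0 = {1..\<tau>\<^sub>0}" using pa_graph_start by (simp add: pa_graph_def)
  have "mean t l = (\<Sum>k\<le>l. mean_count \<tau>\<^sub>0 (\<lambda>k. real (degree_count G\<^sub>0 k)) (t - \<tau>\<^sub>0) k * hit_prob t l t k)"
    by (simp add: mean_def hit_prob_end if_distrib cong: if_cong)
  also have "\<dots> = (\<Sum>k\<le>l. real (degree_count G\<^sub>0 k) * hit_prob t l \<tau>\<^sub>0 k) + (\<Sum>r\<in>{\<tau>\<^sub>0<..t}. hit_prob t l r 1)"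
    using mean_count_duality[of l \<tau>\<^sub>0 "t - \<tau>\<^sub>0" t] assms by simp
  also have "(\<Sum>k\<le>l. real (degree_count G\<^sub>0 k) * hit_prob t l \<tau>\<^sub>0 k) =
      (\<Sum>v\<in>{1..\<tau>\<^sub>0}. hit_prob t l \<tau>\<^sub>0 (degree G\<^sub>0 v))"
    using sum_degree_count[of G\<^sub>0 l "hit_prob t l \<tau>\<^sub>0"] hit_prob_eq_0 assms by (simp add: V)
  finally have *: "mean t l =
      (\<Sum>v\<in>{1..\<tau>\<^sub>0}. hit_prob t l \<tau>\<^sub>0 (degree G\<^sub>0 v)) + (\<Sum>r\<in>{\<tau>\<^sub>0<..t}. hit_prob t l r 1)" .
  show ?thesis
    unfolding potential_def * distrib_left sum_distrib_left
    by (intro add_mono sum_mono tilt_le)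
qed

lemma mean_bound:
  assumes "\<tau>\<^sub>0 \<le> t" "1 \<le> l"
  shows "\<bar>mean t l - (real t - 1) * (4 / (real l * (real l + 1) * (real l + 2)))\<bar> \<le> real \<tau>\<^sub>0"
proof -
  have "degree_count G\<^sub>0 k = 0" if "k \<ge> \<tau>\<^sub>0" for k
    using degree_count_eq_0[OF pa_graph_start _ that] start by simp
  moreover have "degree_count G\<^sub>0 k \<le> \<tau>\<^sub>0" for k
    by (rule degree_count_le[OF pa_graph_start])
  ultimately have "\<bar>mean t l - (real (\<tau>\<^sub>0 + (t - \<tau>\<^sub>0)) - 1) * (4 / (real l * (real l + 1) * (real l + 2)))\<bar> \<le> real \<tau>\<^sub>0"
    unfolding mean_def using start assms(2) by (intro mean_count_bound) auto
  then show ?thesis using assms(1) by simp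
qed

lemma exp_moment:
  assumes \<theta>: "\<bar>\<theta>\<bar> \<le> 1 / 20" and "\<tau>\<^sub>0 \<le> t" "1 \<le> l"
  shows "integrable M (\<lambda>\<omega>. exp (\<theta> * real (degree_count (G t \<omega>) l)))"
    and "expectation (\<lambda>\<omega>. exp (\<theta> * real (degree_count (G t \<omega>) l))) \<le> exp ((\<theta> + 4 * \<theta>\<^sup>2) * mean t l)"
proof -
  show "integrable M (\<lambda>\<omega>. exp (\<theta> * real (degree_count (G t \<omega>) l)))"
    using expectation_G[OF assms(2), of "\<lambda>g. exp (\<theta> * real (degree_count g l))"]
    by (rule integrable.intros)
  have "expectation (\<lambda>\<omega>. exp (\<theta> * real (degree_count (G t \<omega>) l))) =
      expectation (\<lambda>\<omega>. exp (potential \<theta> t l t (G t \<omega>)))"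
  proof (intro integral_cong_AE borel_G)
    show "AE \<omega> in M. exp (\<theta> * real (degree_count (G t \<omega>) l)) = exp (potential \<theta> t l t (G t \<omega>))"
      using AE_pa_graph[OF assms(2)] by eventually_elim (use assms(2) in \<open>simp add: potential_end\<close>)
  qed (use assms in auto)
  also have "\<dots> \<le> exp (potential \<theta> t l \<tau>\<^sub>0 G\<^sub>0)"
    using assms by (intro exp_potential_antimono) auto
  also have "\<dots> \<le> exp ((\<theta> + 4 * \<theta>\<^sup>2) * mean t l)"
    using potential_start assms by simp
  finally show "expectation (\<lambda>\<omega>. exp (\<theta> * real (degree_count (G t \<omega>) l))) \<le> \<dots>" .
qed

text \<open>Chernoff bound. Both signs of \<theta> are allowed: the negative ones give the lower
  tail.\<close>

lemma one_sided_tail: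
  assumes "\<bar>\<theta>\<bar> \<le> 1 / 20" "\<tau>\<^sub>0 \<le> t" "1 \<le> l"
  shows "\<P>(\<omega> in M. \<theta> * (real (degree_count (G t \<omega>) l) - mean t l) \<ge> b) \<le> exp (- b + 4 * \<theta>\<^sup>2 * mean t l)"
proof -
  have "\<P>(\<omega> in M. \<theta> * (real (degree_count (G t \<omega>) l) - mean t l) \<ge> b) =
      \<P>(\<omega> in M. exp (\<theta> * real (degree_count (G t \<omega>) l)) \<ge> exp (b + \<theta> * mean t l))"
    by (intro arg_cong[where f = prob]) (auto simp: algebra_simps)
  also have "\<dots> \<le> expectation (\<lambda>\<omega>. exp (\<theta> * real (degree_count (G t \<omega>) l))) / exp (b + \<theta> * mean t l)"
    by (rule integral_Markov_inequality_measure[OF exp_moment(1)[OF assms] sets.top]) auto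
  also have "\<dots> \<le> exp ((\<theta> + 4 * \<theta>\<^sup>2) * mean t l) / exp (b + \<theta> * mean t l)"
    using exp_moment(2)[OF assms] by (intro divide_right_mono) auto
  also have "\<dots> = exp (- b + 4 * \<theta>\<^sup>2 * mean t l)"
    by (simp add: algebra_simps flip: exp_diff)
  finally show ?thesis .
qed

lemma two_sided_tail:
  assumes \<theta>: "0 < \<theta>" "\<theta> \<le> 1 / 20" and tl: "\<tau>\<^sub>0 \<le> t" "1 \<le> l"
  shows "\<P>(\<omega> in M. \<bar>real (degree_count (G t \<omega>) l) - mean t l\<bar> \<ge> u) \<le> 2 * exp (- \<theta> * u + 4 * \<theta>\<^sup>2 * mean t l)"
proof -
  let ?D = "\<lambda>\<omega>. real (degree_count (G t \<omega>) l) - mean t l"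
  let ?A = "\<lambda>\<eta>. {\<omega> \<in> space M. \<eta> * ?D \<omega> \<ge> \<theta> * u}"
  have ev: "?A \<eta> \<in> events" for \<eta>
    by (rule events_G[OF tl(1), of "\<lambda>g. \<eta> * (real (degree_count g l) - mean t l) \<ge> \<theta> * u"])
  have "{\<omega> \<in> space M. \<bar>?D \<omega>\<bar> \<ge> u} \<subseteq> ?A \<theta> \<union> ?A (- \<theta>)"
  proof
    fix \<omega> assume w: "\<omega> \<in> {\<omega> \<in> space M. \<bar>?D \<omega>\<bar> \<ge> u}"
    then have "\<theta> * u \<le> \<theta> * \<bar>?D \<omega>\<bar>" using \<theta> by (intro mult_left_mono) auto
    with w show "\<omega> \<in> ?A \<theta> \<union> ?A (- \<theta>)" by (auto simp: abs_if algebra_simps split: if_splits)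
  qed
  then have "prob {\<omega> \<in> space M. \<bar>?D \<omega>\<bar> \<ge> u} \<le> prob (?A \<theta> \<union> ?A (- \<theta>))"
    by (rule finite_measure_mono) (intro sets.Un ev)
  also have "\<dots> \<le> prob (?A \<theta>) + prob (?A (- \<theta>))"
    by (intro measure_Un_le ev)
  also have "\<dots> \<le> exp (- (\<theta> * u) + 4 * \<theta>\<^sup>2 * mean t l) + exp (- (\<theta> * u) + 4 * (- \<theta>)\<^sup>2 * mean t l)"
    using \<theta> tl by (intro add_mono one_sided_tail) auto
  finally show ?thesis by simp
qed

section \<open>Union bound over all degrees and times\<close>

context
  fixes \<psi> :: real
  assumes \<psi>: "\<psi> \<ge> 10" "\<psi>\<^sup>2 \<ge> real \<tau>\<^sub>0 + 1"
begin

text \<open>The constant is 300 instead of 301: the remaining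
  \<open>\<psi>\<^sup>2 * ln (\<psi> * real t)\<close> is kept for the distance from
  \<open>mean\<close> to the closed form in \<open>t\<close>.\<close>

definition radius :: "nat \<Rightarrow> nat \<Rightarrow> real" where
  "radius t l = 120 * sqrt (real t * ln (\<psi> * real t) / real l ^ 3) + 300 * \<psi>\<^sup>2 * ln (\<psi> * real t)"

definition deviant :: "nat \<Rightarrow> nat \<Rightarrow> 'a set" where
  "deviant t l = {\<omega> \<in> space M. \<bar>real (degree_count (G t \<omega>) l) - mean t l\<bar> \<ge> radius t l}"

lemma events_deviant: "\<tau>\<^sub>0 \<le> t \<Longrightarrow> deviant t l \<in> events"
  unfolding deviant_def
  by (rule events_G[of t "\<lambda>g. \<bar>real (degree_count g l) - mean t l\<bar> \<ge> radius t l"])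

lemma ln_ge_1:
  assumes "\<tau>\<^sub>0 \<le> t"
  shows "ln (\<psi> * real t) \<ge> 1"
proof -
  have "exp 1 \<le> 10 * (1 :: real)" using exp_le by simp
  also have "\<dots> \<le> \<psi> * real t" using \<psi> assms start by (intro mult_mono) auto
  finally show ?thesis by (subst ln_ge_iff) (use \<psi> assms start in auto)
qed

lemma prob_deviant:
  assumes t: "\<tau>\<^sub>0 \<le> t" and l: "1 \<le> l"
  shows "prob (deviant t l) \<le> 2 / (\<psi> * real t) ^ 4"
proof -
  define L where "L = ln (\<psi> * real t)"
  define a where "a = real t / real l ^ 3"
  have pos: "\<psi> * real t > 0" using \<psi> t start by simp
  have P: "\<psi>\<^sup>2 \<ge> 10" using \<psi>(1) mult_mono[of 1 \<psi> 10 \<psi>] by (simp add: power2_eq_square)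
  \<comment> \<open>Bounding the denominator below by the cube of \<open>l\<close> puts the mean in
    the form \<open>4 * a + s\<close> that \<open>tilt_choice\<close> expects.\<close>
  have "(real t - 1) * (4 / (real l * (real l + 1) * (real l + 2))) \<le> real t * (4 / (real l * real l * real l))"
    using l t start by (intro mult_mono frac_le) (auto intro!: mult_mono)
  also have "\<dots> = 4 * a" by (simp add: a_def power3_eq_cube)
  finally have m: "mean t l \<le> 4 * a + real \<tau>\<^sub>0" using mean_bound[OF t l] by linarith
  have "radius t l \<ge> 120 * sqrt (a * L) + 300 * \<psi>\<^sup>2 * L" by (simp add: radius_def a_def L_def)
  then obtain \<theta> where \<theta>: "0 < \<theta>" "\<theta> \<le> 1 / 20" "- \<theta> * radius t l + 4 * \<theta>\<^sup>2 * mean t l \<le> - 4 * L"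
    using tilt_choice[of a L "\<psi>\<^sup>2" "real \<tau>\<^sub>0" "mean t l" "radius t l"] m \<psi>(2) P ln_ge_1[OF t]
    by (auto simp: L_def a_def)
  have "prob (deviant t l) \<le> 2 * exp (- \<theta> * radius t l + 4 * \<theta>\<^sup>2 * mean t l)"
    unfolding deviant_def by (rule two_sided_tail[OF \<theta>(1,2) t l])
  also have "\<dots> \<le> 2 * exp (- 4 * L)" using \<theta>(3) by simp
  also have "exp (- 4 * L) = 1 / (\<psi> * real t) ^ 4"
    using pos by (simp add: L_def exp_minus exp_of_nat_mult[of 4, simplified] inverse_eq_divide)
  finally show ?thesis by simp
qed

text \<open>Fewer than \<open>t\<close> degrees are in play, which costs a factor \<open>t\<close>
  on top of \<open>2 / (\<psi> * t) ^ 4\<close>. One factor \<open>1 / \<psi>\<close> and the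
  summable \<open>1 / t ^ 2\<close> are kept; the spare \<open>t * \<psi> ^ 3\<close> absorbs the
  2.\<close>

lemma prob_deviant_some:
  "prob (\<Union>l\<in>{1..<\<tau>\<^sub>0 + n}. deviant (\<tau>\<^sub>0 + n) l) \<le> 1 / \<psi> * (1 / (real n + 1)\<^sup>2)"
proof -
  define t where "t = \<tau>\<^sub>0 + n"
  have t: "\<tau>\<^sub>0 \<le> t" "real t > 0" "real n + 1 \<le> real t" "2 \<le> real t" using start by (auto simp: t_def)
  have "prob (\<Union>l\<in>{1..<t}. deviant t l) \<le> (\<Sum>l\<in>{1..<t}. prob (deviant t l))"
    using t events_deviant by (intro finite_measure_subadditive_finite) auto
  also have "\<dots> \<le> (\<Sum>l\<in>{1..<t}. 2 / (\<psi> * real t) ^ 4)"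
    using t by (intro sum_mono prob_deviant) auto
  also have "\<dots> \<le> real t * (2 / (\<psi> * real t) ^ 4)"
    using t by (simp add: of_nat_diff) (intro divide_right_mono, auto)
  also have "\<dots> \<le> 1 / \<psi> * (1 / (real t)\<^sup>2)"
  proof -
    have "2 * (\<psi> * (real t)\<^sup>2 * real t) \<le> (real t * \<psi> ^ 3) * (\<psi> * (real t)\<^sup>2 * real t)"
      using t \<psi> mult_mono[of 2 "real t" 1 "\<psi> ^ 3"] one_le_power[of \<psi> 3] by (intro mult_right_mono) auto
    then show ?thesis using t \<psi> by (simp add: divide_simps) (simp add: algebra_simps eval_nat_numeral)
  qed
  also have "\<dots> \<le> 1 / \<psi> * (1 / (real n + 1)\<^sup>2)"
    using t \<psi> by (intro mult_left_mono divide_left_mono power_mono) auto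
  finally show ?thesis by (simp add: t_def)
qed

text \<open>For \<open>l < t\<close> the error is the radius, plus \<open>\<tau>\<^sub>0\<close>
  from \<open>mean_bound\<close>, plus 1 for replacing \<open>t - 1\<close> by \<open>t\<close>. For
  \<open>l \<ge> t\<close> the count is 0 and the closed form is at most 4.\<close>

lemma degree_count_close:
  assumes g: "pa_graph t (G t \<omega>)" and w: "\<omega> \<in> space M" and t: "\<tau>\<^sub>0 \<le> t" and l: "1 \<le> l"
    and nd: "l < t \<Longrightarrow> \<omega> \<notin> deviant t l"
  shows "\<bar>real (degree_count (G t \<omega>) l) - 4 * real t / (real l * (real l + 1) * (real l + 2))\<bar>
    \<le> 120 * sqrt (real t * ln (\<psi> * real t) / real l ^ 3) + 301 * \<psi>\<^sup>2 * ln (\<psi> * real t)"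
proof -
  define c where "c = 4 / (real l * (real l + 1) * (real l + 2))"
  have "real \<tau>\<^sub>0 + 1 \<le> \<psi>\<^sup>2 * 1" using \<psi> by simp
  also have "\<dots> \<le> \<psi>\<^sup>2 * ln (\<psi> * real t)" using ln_ge_1[OF t] by (intro mult_left_mono) auto
  finally have slack: "real \<tau>\<^sub>0 + 1 \<le> \<psi>\<^sup>2 * ln (\<psi> * real t)" .
  have "\<bar>real (degree_count (G t \<omega>) l) - real t * c\<bar> \<le> radius t l + (real \<tau>\<^sub>0 + 1)"
  proof (cases "l < t")
    case True
    have "1 * 2 * 3 \<le> real l * (real l + 1) * (real l + 2)" using l by (intro mult_mono) auto
    then have c: "0 \<le> c" "c \<le> 1" using l by (auto simp: c_def divide_le_eq)
    have "\<bar>real (degree_count (G t \<omega>) l) - mean t l\<bar> < radius t l"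
      using nd[OF True] w by (simp add: deviant_def)
    moreover have "\<bar>mean t l - (real t - 1) * c\<bar> \<le> real \<tau>\<^sub>0" unfolding c_def by (rule mean_bound[OF t l])
    ultimately show ?thesis using c by (simp add: algebra_simps)
  next
    case False
    have "real t * 1 * 1 \<le> real l * (real l + 1) * (real l + 2)"
      using False by (intro mult_mono) auto
    then have "\<bar>real t * c\<bar> \<le> 4" using l by (simp add: c_def divide_le_eq abs_mult)
    moreover have "degree_count (G t \<omega>) l = 0" using False t start by (intro degree_count_eq_0[OF g]) auto
    moreover have "0 \<le> radius t l" using ln_ge_1[OF t] by (simp add: radius_def)
    ultimately show ?thesis using start by simp
  qed
  moreover have "real t * c = 4 * real t / (real l * (real l + 1) * (real l + 2))" by (simp add: c_def)
  ultimately show ?thesis using slack unfolding radius_def by simp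
qed

lemma degree_concentration:
  "\<P>(\<omega> in M. \<forall>l\<ge>1. \<forall>t\<ge>\<tau>\<^sub>0.
      \<bar>real (degree_count (G t \<omega>) l) - 4 * real t / (real l * (real l + 1) * (real l + 2))\<bar>
        \<le> 120 * sqrt (real t * ln (\<psi> * real t) / real l ^ 3) + 301 * \<psi>\<^sup>2 * ln (\<psi> * real t))
    \<ge> 1 - 4 / \<psi>"
  (is "\<P>(\<omega> in M. \<forall>l\<ge>1. \<forall>t\<ge>\<tau>\<^sub>0. ?close l t \<omega>) \<ge> _")
proof -
  define A where "A n = (\<Union>l\<in>{1..<\<tau>\<^sub>0 + n}. deviant (\<tau>\<^sub>0 + n) l)" for n
  have A: "range A \<subseteq> events" unfolding A_def using events_deviant by auto
  have sums: "(\<lambda>n. 1 / \<psi> * (1 / (real n + 1)\<^sup>2)) sums (1 / \<psi> * (pi\<^sup>2 / 6))"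
    using sums_mult[OF inverse_squares_sums, of "1 / \<psi>"] by (simp add: add.commute)
  have summ: "summable (\<lambda>n. prob (A n))"
    using prob_deviant_some by (intro summable_comparison_test'[OF sums_summable[OF sums]]) (simp add: A_def)
  have "prob (\<Union>n. A n) \<le> (\<Sum>n. prob (A n))"
    by (rule finite_measure_subadditive_countably[OF A summ])
  also have "\<dots> \<le> 1 / \<psi> * (pi\<^sup>2 / 6)"
    unfolding sums_unique[OF sums] A_def
    by (intro suminf_le prob_deviant_some summ[unfolded A_def] sums_summable[OF sums])
  also have "\<dots> \<le> 1 / \<psi> * 4"
  proof -
    have "pi\<^sup>2 \<le> 4\<^sup>2" using pi_less_4 by (intro power_mono) auto
    then show ?thesis using \<psi> by (intro mult_left_mono) auto
  qed
  finally have "1 - 4 / \<psi> \<le> 1 - prob (\<Union>n. A n)" by simp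
  also have "\<dots> = prob (space M - (\<Union>n. A n))"
    using A by (intro prob_compl[symmetric]) auto
  also have "\<dots> \<le> \<P>(\<omega> in M. \<forall>l\<ge>1. \<forall>t\<ge>\<tau>\<^sub>0. ?close l t \<omega>)"
  proof (rule finite_measure_mono_AE)
    \<comment> \<open>One null set has to serve all times at once; indexing them by \<open>n\<close>
      makes the family countable.\<close>
    have "AE \<omega> in M. \<forall>n. pa_graph (\<tau>\<^sub>0 + n) (G (\<tau>\<^sub>0 + n) \<omega>)"
    proof (subst AE_all_countable, intro allI)
      fix n
      show "AE \<omega> in M. pa_graph (\<tau>\<^sub>0 + n) (G (\<tau>\<^sub>0 + n) \<omega>)"
        using AE_pa_graph[OF le_add1[of \<tau>\<^sub>0 n]] by eventually_elim auto
    qed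
    then show "AE \<omega> in M. \<omega> \<in> space M - (\<Union>n. A n) \<longrightarrow>
        \<omega> \<in> {\<omega> \<in> space M. \<forall>l\<ge>1. \<forall>t\<ge>\<tau>\<^sub>0. ?close l t \<omega>}"
    proof eventually_elim
      case (elim \<omega>)
      have "?close l t \<omega>" if w: "\<omega> \<in> space M - (\<Union>n. A n)" and "1 \<le> l" "\<tau>\<^sub>0 \<le> t" for l t
      proof -
        have A_t: "A (t - \<tau>\<^sub>0) = (\<Union>l\<in>{1..<t}. deviant t l)" using \<open>\<tau>\<^sub>0 \<le> t\<close> by (simp add: A_def)
        have "\<omega> \<notin> deviant t l" if "l < t"
        proof
          assume "\<omega> \<in> deviant t l"
          then have "\<omega> \<in> A (t - \<tau>\<^sub>0)" using that \<open>1 \<le> l\<close> unfolding A_t by auto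
          with w show False by blast
        qed
        moreover have "pa_graph t (G t \<omega>)" using elim[rule_format, of "t - \<tau>\<^sub>0"] \<open>\<tau>\<^sub>0 \<le> t\<close> by simp
        ultimately show ?thesis using that by (intro degree_count_close) auto
      qed
      then show ?case by auto
    qed
    have ev: "{\<omega> \<in> space M. ?close l t \<omega>} \<in> events" if "\<tau>\<^sub>0 \<le> t" for l t
      using events_G[OF that, of "\<lambda>g. \<bar>real (degree_count g l)
          - 4 * real t / (real l * (real l + 1) * (real l + 2))\<bar>
        \<le> 120 * sqrt (real t * ln (\<psi> * real t) / real l ^ 3) + 301 * \<psi>\<^sup>2 * ln (\<psi> * real t)"] .
    have *: "{\<omega> \<in> space M. \<forall>l\<ge>1. \<forall>t\<ge>\<tau>\<^sub>0. ?close l t \<omega>} =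
        {\<omega> \<in> space M. \<forall>l\<in>{1..}. \<forall>t\<in>{\<tau>\<^sub>0..}. ?close l t \<omega>}" by auto
    show "{\<omega> \<in> space M. \<forall>l\<ge>1. \<forall>t\<ge>\<tau>\<^sub>0. ?close l t \<omega>} \<in> events"
      unfolding * by (intro sets.sets_Collect_countable_All' ev) auto
  qed
  finally show ?thesis .
qed

end

end

theorem theorem1p1:
  fixes M :: "'a measure" and \<tau>\<^sub>0 :: nat and \<psi> :: real
    and G\<^sub>0 :: "nat graph" and G :: "nat \<Rightarrow> 'a \<Rightarrow> nat graph"
  assumes "\<tau>\<^sub>0 \<ge> 4"
    and "\<psi> \<ge> 10 ^ 5 * sqrt (real \<tau>\<^sub>0 - 1) * (ln (real \<tau>\<^sub>0)) ^ 3"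
    and "simple_graph G\<^sub>0" and "verts G\<^sub>0 = {1..\<tau>\<^sub>0}" and "card (edges G\<^sub>0) = \<tau>\<^sub>0 - 1"
    and "preferential_attachment M \<tau>\<^sub>0 G\<^sub>0 G"
  shows "\<P>(\<omega> in M. \<forall>l\<ge>1. \<forall>t\<ge>\<tau>\<^sub>0.
      \<bar>real (degree_count (G t \<omega>) l) - 4 * real t / (real l * (real l + 1) * (real l + 2))\<bar>
        \<le> 120 * sqrt (real t * ln (\<psi> * real t) / real l ^ 3) + 301 * \<psi>\<^sup>2 * ln (\<psi> * real t))
    \<ge> 1 - 4 / \<psi>"
proof -
  have "attachment_tree M \<tau>\<^sub>0 G\<^sub>0 G"
    using assms by (simp add: attachment_tree_def attachment_tree_axioms_def pa_graph_def)
  \<comment> \<open>As \<open>\<tau>\<^sub>0 \<ge> 4\<close> exceeds e, the logarithmic factor is at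
    least 1. Both conditions on \<psi> in \<open>degree_concentration\<close> follow from this
    bound.\<close>
  moreover have \<psi>: "10 * sqrt (real \<tau>\<^sub>0 - 1) \<le> \<psi>"
  proof -
    have "exp 1 \<le> real \<tau>\<^sub>0" using exp_le assms(1) by linarith
    then have "1 \<le> ln (real \<tau>\<^sub>0)" using assms(1) by (subst ln_ge_iff) auto
    then have "1 \<le> ln (real \<tau>\<^sub>0) ^ 3" by (rule one_le_power)
    then have "10 * sqrt (real \<tau>\<^sub>0 - 1) * 1 \<le> 10 ^ 5 * sqrt (real \<tau>\<^sub>0 - 1) * ln (real \<tau>\<^sub>0) ^ 3"
      using assms(1) by (intro mult_mono) auto
    then show ?thesis using assms(2) by simp
  qed
  moreover have "10 \<le> \<psi>"
  proof -
    have "1 \<le> sqrt (real \<tau>\<^sub>0 - 1)" using assms(1) by simp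
    with \<psi> show ?thesis by linarith
  qed
  moreover have "real \<tau>\<^sub>0 + 1 \<le> \<psi>\<^sup>2"
  proof -
    have "(10 * sqrt (real \<tau>\<^sub>0 - 1))\<^sup>2 \<le> \<psi>\<^sup>2" using \<psi> assms(1) by (intro power_mono) auto
    then show ?thesis using assms(1) by (simp add: power_mult_distrib)
  qed
  ultimately show ?thesis by (intro attachment_tree.degree_concentration)
qed

end
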